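(* For each $f\in\mathcal{U}$ there is a probability measure $\mu$ on the unit circle $\{x\in\mathbb{C}:|x|=1\}$ such that $$f(z)=\int_{|x|=1}\frac{z}{(1-xz)^2}\,d\mu(x),\qquad z\in\mathbb{D}.$$ Moreover, $\mathcal{U}\subsetneq\overline{co}\,\mathcal{S}^*$ (proper inclusion).
   Context: $\mathbb{D}=\{z\in\mathbb{C}:|z|<1\}$. $\mathcal{H}$ is the space of analytic functions on $\mathbb{D}$ with the topology of uniform convergence on compact subsets of $\mathbb{D}$. $\mathcal{A}$ is the set of $f\in\mathcal{H}$ of the form $f(z)=z+\sum_{n=2}^\infty a_nz^n$. $\mathcal{U}$ is the class of $f\in\mathcal{A}$ satisfying $\left|f'(z)\left(\frac{z}{f(z)}\right)^2-1\right|<1$ for all $z\in\mathbb{D}$ (where $z/f(z)$ has the value $1$ at $z=0$; such $f$ is nonvanishing in $\mathbb{D}\setminus\{0\}$). $\mathcal{S}^*$ is the class of starlike functions: univalent $f\in\mathcal{A}$ such that $f(\mathbb{D})$ is starlike with respect to the origin; equivalently, $f\in\mathcal{A}$ with $\mathrm{Re}\,(zf'(z)/f(z))>0$ in $\mathbb{D}$. $\overline{co}\,\mathcal{S}^*$ is the closed convex hull of $\mathcal{S}^*$ in $\mathcal{H}$, i.e. the intersection of all closed convex subsets of $\mathcal{H}$ containing $\mathcal{S}^*$. *)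

theory Defs
  imports "HOL-Complex_Analysis.Complex_Analysis" "HOL-Probability.Probability"
begin

abbreviation unit_disc :: "complex set" where
  "unit_disc \<equiv> ball 0 1"

text \<open>
  Functions on the disc are modelled as total functions that are \<open>0\<close> off the disc, so that
  equality and set inclusion only see the values on the disc; pointwise linear combinations
  respect this normalisation.
\<close>

definition disc_analytic :: "(complex \<Rightarrow> complex) set" where
  "disc_analytic = {f. f holomorphic_on unit_disc \<and> (\<forall>z. z \<notin> unit_disc \<longrightarrow> f z = 0)}"

definition disc_nbhd :: "(complex \<Rightarrow> complex) \<Rightarrow> complex set \<Rightarrow> real \<Rightarrow> (complex \<Rightarrow> complex) set" where
  "disc_nbhd f K \<epsilon> = {g \<in> disc_analytic. \<forall>z\<in>K. cmod (g z - f z) < \<epsilon>}"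

text \<open>
  Uniform convergence on compact subsets of the disc.  The type class topology on functions
  (pointwise convergence) is not the one meant here.
\<close>

definition disc_topology :: "(complex \<Rightarrow> complex) topology" where
  "disc_topology = topology_generated_by
     {disc_nbhd f K \<epsilon> | f K \<epsilon>. f \<in> disc_analytic \<and> compact K \<and> K \<subseteq> unit_disc \<and> \<epsilon> > 0}"

lemma topspace_disc_topology [simp]: "topspace disc_topology = disc_analytic"
proof
  show "topspace disc_topology \<subseteq> disc_analytic"
    unfolding disc_topology_def topology_generated_by_topspace disc_nbhd_def by blast
  show "disc_analytic \<subseteq> topspace disc_topology"
  proof
    fix f assume f: "f \<in> disc_analytic"
    have "f \<in> disc_nbhd f {} 1"
      using f by (simp add: disc_nbhd_def)
    moreover have "compact ({} :: complex set)" "{} \<subseteq> unit_disc" "(1 :: real) > 0"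
      by simp_all
    ultimately show "f \<in> topspace disc_topology"
      unfolding disc_topology_def topology_generated_by_topspace using f by blast
  qed
qed

text \<open>The function type is not an instance of \<^class>\<open>real_vector\<close>, hence this
  pointwise copy of \<^const>\<open>convex\<close>.\<close>

definition fun_convex :: "(complex \<Rightarrow> complex) set \<Rightarrow> bool" where
  "fun_convex C \<longleftrightarrow> (\<forall>f\<in>C. \<forall>g\<in>C. \<forall>u\<ge>0. \<forall>v\<ge>0. u + v = 1 \<longrightarrow>
     (\<lambda>z. u *\<^sub>R f z + v *\<^sub>R g z) \<in> C)"

definition closed_convex_hull :: "(complex \<Rightarrow> complex) set \<Rightarrow> (complex \<Rightarrow> complex) set" where
  "closed_convex_hull S = (\<lambda>C. closedin disc_topology C \<and> fun_convex C) hull S"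

definition class_A :: "(complex \<Rightarrow> complex) set" where
  "class_A = {f \<in> disc_analytic. \<exists>a :: nat \<Rightarrow> complex. \<forall>z\<in>unit_disc.
     (\<lambda>n. a (n + 2) * z ^ (n + 2)) sums (f z - z)}"

text \<open>\<open>z / f z\<close> with its removable singularity at the origin filled in.\<close>

definition id_over :: "(complex \<Rightarrow> complex) \<Rightarrow> complex \<Rightarrow> complex" where
  "id_over f z = (if z = 0 then 1 else z / f z)"

definition class_U :: "(complex \<Rightarrow> complex) set" where
  "class_U = {f \<in> class_A. (\<forall>z\<in>unit_disc - {0}. f z \<noteq> 0) \<and>
     (\<forall>z\<in>unit_disc. cmod (deriv f z * (id_over f z)\<^sup>2 - 1) < 1)}"

text \<open>\<^const>\<open>starlike\<close> leaves the centre existential; here it is the origin.\<close>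

definition starlike_functions :: "(complex \<Rightarrow> complex) set" where
  "starlike_functions = {f \<in> class_A. inj_on f unit_disc \<and>
     (\<forall>w\<in>f ` unit_disc. closed_segment 0 w \<subseteq> f ` unit_disc)}"

definition circle_prob_measure :: "complex measure \<Rightarrow> bool" where
  "circle_prob_measure \<mu> \<longleftrightarrow>
     prob_space \<mu> \<and> sets \<mu> = sets (restrict_space borel (sphere 0 1))"

end

theory Submission
  imports Defs
begin

text \<open>
  The kernel \<open>1 / (1 - x z)\<^sup>2\<close> is the derivative of \<open>z / (1 - x z)\<close>, so it suffices to represent the radial
  mean \<open>H\<close> of \<open>f(z) / z\<close> by the kernel \<open>1 / (1 - x z)\<close>, which is possible as soon as \<open>Re H > 1/2\<close>.  This
  inequality comes from two applications of Jack's lemma: at the first radius at which a holomorphic \<open>\<omega>\<close>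
  with \<open>\<omega> 0 = 0\<close> reaches modulus \<open>1\<close>, say at \<open>z\<^sub>0\<close>, the quotient \<open>z\<^sub>0 \<omega>'(z\<^sub>0) / \<omega>(z\<^sub>0)\<close> is a real
  number \<open>k \<ge> 1\<close>.

  For \<open>f\<close> in the class U write \<open>z / f(z) = q(z)\<^sup>2\<close> with \<open>q 0 = 1\<close> and put \<open>\<omega> = 1 - q\<close>.  If \<open>|\<omega>|\<close> reached
  \<open>1\<close>, then at \<open>z\<^sub>0\<close> the quantity \<open>f' (z / f)\<^sup>2 - 1\<close>, which equals \<open>q\<^sup>2 - 2 z q q' - 1\<close>, would be
  \<open>\<omega> (2 (k - 1) - (2 k - 1) \<omega>)\<close>, of modulus at least \<open>(2 k - 1) - 2 (k - 1) = 1\<close>.  So \<open>|1 - q| < 1\<close>, and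
  \<open>F = f / z = 1 / q\<^sup>2\<close> takes its values in the parabolic region \<open>|W| + Re W > 1/2\<close>, the image of the
  half-plane \<open>Re > 1/2\<close> under squaring (\<open>class_U_root_bound\<close>, \<open>inverse_square_in_parabola\<close>).

  Let \<open>H(z)\<close> be the mean of \<open>F\<close> over the segment from \<open>0\<close> to \<open>z\<close>, so that \<open>(z H)' = F\<close>.  A second use of
  Jack's lemma, now for \<open>1 - 1 / H\<close>, shows that \<open>Re H > 1/2\<close>
  (\<open>mean_of_parabola_in_half_plane\<close>).  By Herglotz's theorem \<open>H\<close> is then an average of the functions
  \<open>1 / (1 - x z)\<close>, and differentiating \<open>z H(z)\<close> turns this into the average of \<open>1 / (1 - x z)\<^sup>2\<close> for \<open>F\<close>.
  The measure is a weak limit of the densities \<open>(2 Re H - 1) / 2\<pi>\<close> on circles of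
  radius less than \<open>1\<close> (\<open>half_plane_representation\<close>).

  The functions \<open>z / (1 - x z)\<^sup>2\<close> are starlike, and an average of them is a locally uniform limit of
  finite convex combinations, hence lies in the closed convex hull (\<open>koebe_average_in_hull\<close>).
  The inclusion is proper because the mean of \<open>z / (1 - z)\<^sup>2\<close> and \<open>z / (1 + z)\<^sup>2\<close> violates the
  defining inequality of U at \<open>\<i> / 2\<close> (\<open>hull_not_class_U\<close>).
\<close>

section \<open>Jack's lemma\<close>

text \<open>
  Take a point of least modulus in the compact set where \<open>c \<le> u\<close>.  On the segment from \<open>0\<close> to it, the
  intermediate value theorem gives a point with value exactly \<open>c\<close>, which by minimality is the end point.
\<close>

lemma first_exit:
  fixes u :: "complex \<Rightarrow> real"
  assumes cont: "continuous_on (ball 0 R) u" and u0: "u 0 < c"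
    and z1: "z1 \<in> ball 0 R" "c \<le> u z1"
  obtains z0 where "z0 \<in> ball 0 R" "z0 \<noteq> 0" "u z0 = c" "\<And>z. cmod z < cmod z0 \<Longrightarrow> u z < c"
proof -
  define K where "K = {z \<in> cball 0 (cmod z1). c \<le> u z}"
  have sub: "cball 0 (cmod z1) \<subseteq> ball 0 R" using z1 by auto
  have "compact K"
  proof -
    have "closed K" unfolding K_def
      by (rule continuous_on_closed_Collect_le) (auto intro: continuous_on_subset[OF cont sub])
    then show ?thesis unfolding K_def
      by (metis (no_types, lifting) bounded_cball bounded_subset compact_eq_bounded_closed mem_Collect_eq subsetI)
  qed
  moreover have "K \<noteq> {}" using z1 by (auto simp: K_def)
  ultimately obtain z0 where z0: "z0 \<in> K" and min: "\<And>z. z \<in> K \<Longrightarrow> cmod z0 \<le> cmod z"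
    using continuous_attains_inf[of K cmod] continuous_on_norm_id by blast
  have z0R: "cmod z0 \<le> cmod z1" "c \<le> u z0" using z0 by (auto simp: K_def)
  have less: "u z < c" if "cmod z < cmod z0" for z
    using min[of z] that z0R by (force simp: K_def)
  have z0n: "z0 \<noteq> 0" using u0 z0R by auto
  have z0b: "z0 \<in> ball 0 R" using z1 z0R by auto
  have seg: "continuous_on {0..1} (\<lambda>t. u (of_real t * z0))"
  proof (rule continuous_on_compose2[OF cont])
    show "(\<lambda>t. of_real t * z0) ` {0..1} \<subseteq> ball 0 R"
      using z0b by (auto simp: norm_mult intro!: le_less_trans[OF mult_left_le_one_le])
  qed (intro continuous_intros)
  obtain t where t: "0 \<le> t" "t \<le> 1" "u (of_real t * z0) = c"
    using IVT'[of "\<lambda>t. u (of_real t * z0)" 0 c 1] seg u0 z0R by auto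
  have "t = 1"
  proof (rule ccontr)
    assume "t \<noteq> 1"
    then have "cmod (of_real t * z0) < cmod z0" using t z0n by (simp add: norm_mult)
    from less[OF this] t show False by simp
  qed
  then have "u z0 = c" using t by simp
  then show thesis using that z0b z0n less by blast
qed

text \<open>
  By the Schwarz lemma \<open>|\<omega> z| \<le> |z| / |z\<^sub>0|\<close>, with equality at \<open>z\<^sub>0\<close>.  Comparing the two sides to first
  order along the curves \<open>s \<mapsto> z\<^sub>0 exp (c s)\<close>, which run into the disc when \<open>Re c < 0\<close>, gives
  \<open>Re (\<kappa> c) \<le> Re c\<close> for \<open>\<kappa> = z\<^sub>0 \<omega>'(z\<^sub>0) / \<omega>(z\<^sub>0)\<close>.  The choice \<open>c = -1\<close> gives \<open>Re \<kappa> \<ge> 1\<close>, and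
  \<open>c = -1 + \<i> t\<close> with \<open>t\<close> of large modulus and either sign forces \<open>Im \<kappa> = 0\<close>.
\<close>

lemma Jack:
  fixes \<omega> :: "complex \<Rightarrow> complex"
  assumes hol: "\<omega> holomorphic_on ball 0 (cmod z0)" and w0: "\<omega> 0 = 0"
    and lt: "\<And>z. cmod z < cmod z0 \<Longrightarrow> cmod (\<omega> z) < 1"
    and bd: "cmod (\<omega> z0) = 1" and der: "(\<omega> has_field_derivative d) (at z0)"
  obtains k :: real where "k \<ge> 1" "z0 * d = of_real k * \<omega> z0"
proof -
  define r where "r = cmod z0"
  have r: "r > 0" using bd w0 by (auto simp: r_def)
  have schwarz: "cmod (\<omega> z) \<le> cmod z / r" if z: "cmod z < r" for z
  proof -
    have "cmod ((\<lambda>w. \<omega> (of_real r * w)) (z / of_real r)) \<le> cmod (z / of_real r)"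
    proof (rule Schwarz_Lemma(1))
      show "(\<lambda>w. \<omega> (of_real r * w)) holomorphic_on ball 0 1"
        using r by (intro holomorphic_on_compose_gen[OF _ hol, unfolded o_def] holomorphic_intros)
          (auto simp: norm_mult r_def)
      show "cmod (\<omega> (of_real r * w)) < 1" if "cmod w < 1" for w
        using that r by (intro lt) (auto simp: norm_mult r_def)
      show "cmod (z / of_real r) < 1" using z r by (simp add: norm_divide)
    qed (simp add: w0)
    then show ?thesis using r by (simp add: norm_divide)
  qed
  \<comment> \<open>Since \<open>|\<omega> z0| = 1\<close>, multiplying by the conjugate is dividing by \<open>\<omega> z0\<close>.\<close>
  define \<kappa> where "\<kappa> = z0 * d * cnj (\<omega> z0)"
  have key: "Re (\<kappa> * c) \<le> Re c" if c: "Re c < 0" for c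
  proof (rule ccontr)
    assume neg: "\<not> ?thesis"
    define g where "g s = \<omega> (z0 * exp (c * of_real s))" for s :: real
    define \<phi> where "\<phi> s = (Re (g s))\<^sup>2 + (Im (g s))\<^sup>2 - exp (2 * s * Re c)" for s
    have "((\<lambda>s. z0 * exp (c * of_real s)) has_vector_derivative z0 * c) (at (0::real))"
      by (rule derivative_eq_intros has_vector_derivative_real_field | simp)+
    then have g': "(g has_vector_derivative (z0 * c * d)) (at 0)"
      using field_vector_diff_chain_at[of "\<lambda>s. z0 * exp (c * of_real s)" "z0 * c" 0 \<omega> d] der
      by (simp add: g_def[abs_def] o_def)
    have "(\<phi> has_real_derivative
        2 * Re (g 0) * Re (z0 * c * d) + 2 * Im (g 0) * Im (z0 * c * d) - 2 * Re c) (at 0)"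
      unfolding \<phi>_def
      by (rule derivative_eq_intros has_field_derivative_Re[OF g'] has_field_derivative_Im[OF g'] | simp)+
    moreover have "2 * Re (g 0) * Re (z0 * c * d) + 2 * Im (g 0) * Im (z0 * c * d) - 2 * Re c
        = 2 * (Re (\<kappa> * c) - Re c)"
      by (simp add: \<kappa>_def g_def algebra_simps)
    ultimately have "(\<phi> has_real_derivative 2 * (Re (\<kappa> * c) - Re c)) (at 0)" by simp
    from DERIV_pos_inc_right[OF this] neg obtain \<delta> where
      \<delta>: "\<delta> > 0" "\<And>h. 0 < h \<Longrightarrow> h < \<delta> \<Longrightarrow> \<phi> 0 < \<phi> h" by auto
    define h where "h = \<delta> / 2"
    have h: "h > 0" "h < \<delta>" using \<delta> by (auto simp: h_def)
    have "\<phi> 0 = 0" using bd by (simp add: \<phi>_def g_def cmod_def)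
    have n: "cmod (z0 * exp (c * of_real h)) = r * exp (h * Re c)"
      by (simp add: norm_mult r_def mult.commute)
    have "exp (h * Re c) < 1" using h c by (simp add: mult_pos_neg)
    then have "cmod (z0 * exp (c * of_real h)) < r" unfolding n using r by simp
    from schwarz[OF this] have "cmod (g h) \<le> exp (h * Re c)" unfolding n g_def using r by simp
    then have "(cmod (g h))\<^sup>2 \<le> (exp (h * Re c))\<^sup>2" by (intro power_mono) auto
    then have "\<phi> h \<le> 0" by (simp add: \<phi>_def cmod_power2 flip: exp_double) (simp add: algebra_simps)
    with \<delta>(2)[OF h] \<open>\<phi> 0 = 0\<close> show False by simp
  qed
  have re: "Re \<kappa> \<ge> 1" using key[of "-1"] by simp
  have im: "- (Re \<kappa> - 1) \<le> Im \<kappa> * t" for t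
    using key[of "Complex (-1) t"] by simp
  have "Im \<kappa> = 0"
  proof (rule ccontr)
    assume nz: "Im \<kappa> \<noteq> 0"
    then show False using im[of "- Re \<kappa> / Im \<kappa>"] by simp
  qed
  then have "\<kappa> = of_real (Re \<kappa>)" by (simp add: complex_eq_iff)
  moreover have "\<kappa> * \<omega> z0 = z0 * d"
  proof -
    have "cnj (\<omega> z0) * \<omega> z0 = 1"
      using bd by (metis complex_norm_square mult.commute of_real_1 power_one)
    then show ?thesis by (simp add: \<kappa>_def mult.assoc)
  qed
  ultimately show thesis using that[of "Re \<kappa>"] re by metis
qed

section \<open>Functions of class U and their radial means\<close>

lemma class_AD:
  assumes "f \<in> class_A"
  shows "f holomorphic_on unit_disc" "f 0 = 0" "deriv f 0 = 1"
proof -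
  from assms obtain a :: "nat \<Rightarrow> complex" where hol: "f holomorphic_on unit_disc"
    and a: "\<And>z. z \<in> unit_disc \<Longrightarrow> (\<lambda>n. a (n + 2) * z ^ (n + 2)) sums (f z - z)"
    unfolding class_A_def disc_analytic_def by blast
  show "f holomorphic_on unit_disc" by (rule hol)
  define b where "b n = (if n = 0 then 0 else if n = 1 then 1 else a n)" for n :: nat
  have b: "(\<lambda>n. b n * z ^ n) sums f z" if "z \<in> unit_disc" for z
  proof -
    have "(\<lambda>n. b (n + 2) * z ^ (n + 2)) sums (f z - (\<Sum>n<2. b n * z ^ n))"
      using a[OF that] by (simp add: b_def numeral_2_eq_2)
    then show ?thesis by (rule sums_iff_shift'[where f = "\<lambda>n. b n * z ^ n", THEN iffD1])
  qed
  show "f 0 = 0" using b[of 0] by (simp add: b_def sums_iff)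
  have "summable (\<lambda>n. b n * (1/2) ^ n)" using b[of "1/2"] by (simp add: sums_iff norm_divide)
  from termdiffs_strong[OF this, of 0]
  have "((\<lambda>z. \<Sum>n. b n * z ^ n) has_field_derivative 1) (at 0)"
    by (simp add: powser_zero diffs_def b_def)
  then have "(f has_field_derivative 1) (at 0)"
    by (rule DERIV_cong_ev[THEN iffD1, rotated 3, OF _ refl _ refl])
      (auto simp: eventually_nhds sums_iff intro!: exI[of _ unit_disc] dest!: b)
  then show "deriv f 0 = 1" by (rule DERIV_imp_deriv)
qed

lemma class_AI:
  assumes f: "f \<in> disc_analytic" and f0: "f 0 = 0" and f1: "deriv f 0 = 1"
  shows "f \<in> class_A"
proof -
  define a where "a n = (deriv ^^ n) f 0 / fact n" for n
  have "(\<lambda>n. a (n + 2) * z ^ (n + 2)) sums (f z - z)" if z: "z \<in> unit_disc" for z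
  proof -
    have "(\<lambda>n. a n * (z - 0) ^ n) sums f z"
      unfolding a_def using f z by (intro holomorphic_power_series) (auto simp: disc_analytic_def)
    then have "(\<lambda>n. a (n + 2) * z ^ (n + 2)) sums (f z - (\<Sum>n<2. a n * z ^ n))"
      by (intro sums_iff_shift'[where f = "\<lambda>n. a n * z ^ n", THEN iffD2]) simp
    then show ?thesis using f0 f1 by (simp add: a_def numeral_2_eq_2)
  qed
  with f show ?thesis unfolding class_A_def by blast
qed

text \<open>
  The function \<open>z / f(z)\<close> is holomorphic and zero-free on the disc, so it has a square root there; dividing
  by its value at \<open>0\<close>, which is \<open>1\<close> or \<open>-1\<close>, picks the branch with \<open>q 0 = 1\<close>.
\<close>

lemma class_U_root:
  assumes f: "f \<in> class_U"
  obtains q where "q holomorphic_on unit_disc" "q 0 = 1" "\<And>z. z \<in> unit_disc \<Longrightarrow> q z \<noteq> 0"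
    "\<And>z. z \<in> unit_disc \<Longrightarrow> f z = z / (q z)\<^sup>2" "\<And>z. z \<in> unit_disc \<Longrightarrow> id_over f z = (q z)\<^sup>2"
proof -
  have A: "f \<in> class_A" and nz: "\<And>z. z \<in> unit_disc \<Longrightarrow> z \<noteq> 0 \<Longrightarrow> f z \<noteq> 0"
    using f by (auto simp: class_U_def)
  note n = class_AD[OF A]
  define F where "F z = (if z = 0 then deriv f 0 else (f z - f 0) / (z - 0))" for z
  have F: "F holomorphic_on unit_disc" unfolding F_def
    by (rule pole_lemma) (use n in auto)
  have F': "F z \<noteq> 0" "id_over f z = 1 / F z" if "z \<in> unit_disc" for z
    using that n nz by (auto simp: F_def id_over_def)
  have "(\<lambda>z. 1 / F z) holomorphic_on unit_disc" using F F' by (intro holomorphic_intros) auto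
  then obtain q where q: "q holomorphic_on unit_disc" "\<And>z. z \<in> unit_disc \<Longrightarrow> 1 / F z = (q z)\<^sup>2"
    by (rule contractible_imp_holomorphic_sqrt) (use F' in \<open>auto intro: convex_imp_contractible\<close>)
  have q0: "(q 0)\<^sup>2 = 1" using q(2)[of 0] n by (simp add: F_def)
  show thesis
  proof (rule that[of "\<lambda>z. q z / q 0"])
    show "(\<lambda>z. q z / q 0) holomorphic_on unit_disc" using q q0 by (intro holomorphic_intros) auto
    show "q 0 / q 0 = 1" using q0 by auto
    fix z assume z: "z \<in> unit_disc"
    have sq: "(q z / q 0)\<^sup>2 = 1 / F z" using q(2)[OF z] q0 by (simp add: power_divide)
    show "id_over f z = (q z / q 0)\<^sup>2" using sq F'[OF z] by simp
    show "q z / q 0 \<noteq> 0" using sq F'[OF z] by auto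
    show "f z = z / (q z / q 0)\<^sup>2" unfolding sq using n by (simp add: F_def)
  qed
qed

text \<open>
  At a first point \<open>z\<^sub>0\<close> with \<open>|1 - q| = 1\<close>, Jack's lemma for \<open>\<omega> = 1 - q\<close> gives \<open>z\<^sub>0 q' = - k \<omega>\<close>, and the
  quantity bounded in the definition of U becomes \<open>\<omega> (2 (k - 1) - (2 k - 1) \<omega>)\<close>.  Its modulus is at least
  \<open>1\<close>, which is a contradiction.
\<close>

lemma class_U_root_bound:
  assumes f: "f \<in> class_U" and q: "q holomorphic_on unit_disc" "q 0 = 1"
    and qnz: "\<And>z. z \<in> unit_disc \<Longrightarrow> q z \<noteq> 0"
    and fq: "\<And>z. z \<in> unit_disc \<Longrightarrow> f z = z / (q z)\<^sup>2"
    and idq: "\<And>z. z \<in> unit_disc \<Longrightarrow> id_over f z = (q z)\<^sup>2"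
    and z: "z \<in> unit_disc"
  shows "cmod (1 - q z) < 1"
proof (rule ccontr)
  assume neg: "\<not> ?thesis"
  define \<omega> where "\<omega> = (\<lambda>z. 1 - q z)"
  have hol: "\<omega> holomorphic_on unit_disc" unfolding \<omega>_def by (intro holomorphic_intros q)
  have "continuous_on unit_disc (\<lambda>z. cmod (\<omega> z))"
    using holomorphic_on_imp_continuous_on[OF hol] by (intro continuous_intros)
  then obtain z0 where z0: "z0 \<in> unit_disc" "cmod (\<omega> z0) = 1"
      "\<And>z. cmod z < cmod z0 \<Longrightarrow> cmod (\<omega> z) < 1"
    by (rule first_exit[of 1 "\<lambda>z. cmod (\<omega> z)" 1 z]) (use neg z q in \<open>auto simp: \<omega>_def\<close>)
  define q' where "q' = deriv q z0"
  have q': "(q has_field_derivative q') (at z0)"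
    unfolding q'_def using holomorphic_derivI[OF q(1) _ z0(1)] by auto
  have \<omega>': "(\<omega> has_field_derivative - q') (at z0)"
    unfolding \<omega>_def using q' by (auto intro!: derivative_eq_intros)
  have sub: "ball 0 (cmod z0) \<subseteq> unit_disc" using z0 by auto
  obtain k :: real where k: "k \<ge> 1" "z0 * (- q') = of_real k * \<omega> z0"
    by (rule Jack[OF holomorphic_on_subset[OF hol sub] _ z0(3) z0(2) \<omega>'])
      (use q in \<open>auto simp: \<omega>_def\<close>)
  have qz: "q z0 \<noteq> 0" using qnz z0 by auto
  have "((\<lambda>z. (q z)\<^sup>2) has_field_derivative 2 * q z0 * q') (at z0)"
    by (auto intro!: derivative_eq_intros q')
  from DERIV_divide[OF DERIV_ident this] qz
  have "((\<lambda>z. z / (q z)\<^sup>2) has_field_derivative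
      ((q z0)\<^sup>2 - 2 * z0 * q z0 * q') / ((q z0)\<^sup>2)\<^sup>2) (at z0)"
    by (simp add: power2_eq_square mult_ac)
  then have "(f has_field_derivative ((q z0)\<^sup>2 - 2 * z0 * q z0 * q') / ((q z0)\<^sup>2)\<^sup>2) (at z0)"
    by (rule has_field_derivative_transform_within_open[of _ _ _ unit_disc]) (use fq z0 in auto)
  then have "deriv f z0 * (id_over f z0)\<^sup>2 = (q z0)\<^sup>2 - 2 * z0 * q z0 * q'"
    using qz idq[OF z0(1)] by (simp add: DERIV_imp_deriv)
  moreover have "(q z0)\<^sup>2 - 2 * z0 * q z0 * q' - 1
      = \<omega> z0 * (of_real (2 * (k - 1)) - of_real (2 * k - 1) * \<omega> z0)"
  proof -
    have q\<omega>: "q z0 = 1 - \<omega> z0" by (simp add: \<omega>_def)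
    have "z0 * q' = - of_real k * \<omega> z0" using k(2) by (metis minus_minus mult_minus_left mult_minus_right)
    then have "2 * q z0 * (z0 * q') = 2 * q z0 * (- of_real k * \<omega> z0)" by simp
    then have "2 * z0 * q z0 * q' = - 2 * of_real k * \<omega> z0 * q z0" by (simp add: mult_ac)
    then have "(q z0)\<^sup>2 - 2 * z0 * q z0 * q' - 1
        = (q z0)\<^sup>2 - - 2 * of_real k * \<omega> z0 * q z0 - 1" by (simp only:)
    also have "\<dots> = \<omega> z0 * (of_real (2 * (k - 1)) - of_real (2 * k - 1) * \<omega> z0)"
      unfolding q\<omega> by (simp add: power2_eq_square algebra_simps)
    finally show ?thesis .
  qed
  moreover have "cmod (\<dots>) \<ge> 1"
  proof -
    have "cmod (of_real (2 * k - 1) * \<omega> z0) - cmod (of_real (2 * (k - 1)))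
        \<le> cmod (of_real (2 * (k - 1)) - of_real (2 * k - 1) * \<omega> z0)"
      by (metis norm_minus_commute norm_triangle_ineq2)
    moreover have "cmod (of_real (2 * k - 1) * \<omega> z0) = 2 * k - 1"
      using k z0(2) by (simp only: norm_mult norm_of_real) simp
    moreover have "cmod (of_real (2 * (k - 1))) = 2 * (k - 1)"
      using k by (simp only: norm_of_real) simp
    ultimately show ?thesis using z0(2) by (simp add: norm_mult)
  qed
  ultimately have "cmod (deriv f z0 * (id_over f z0)\<^sup>2 - 1) \<ge> 1" by simp
  with f z0(1) show False by (force simp: class_U_def)
qed

text \<open>
  Inversion maps the disc \<open>|1 - q| < 1\<close> to the half-plane \<open>Re g > 1/2\<close>, and
  \<open>|g\<^sup>2| + Re (g\<^sup>2) = 2 (Re g)\<^sup>2\<close>.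
\<close>

lemma inverse_square_in_parabola:
  assumes "cmod (1 - q) < 1" "q \<noteq> 0"
  shows "cmod (1 / q\<^sup>2) + Re (1 / q\<^sup>2) > 1 / 2"
proof -
  define g where "g = 1 / q"
  have "(cmod (1 - q))\<^sup>2 < 1" using assms by (simp add: power_less_one_iff)
  then have "2 * Re q > (cmod q)\<^sup>2"
    unfolding cmod_power2 by (simp add: power2_eq_square algebra_simps)
  then have *: "Re g > 1 / 2"
    using assms by (simp add: g_def Re_divide cmod_power2 field_simps sum_power2_gt_zero_iff complex_neq_0)
  have "cmod (g\<^sup>2) + Re (g\<^sup>2) = 2 * (Re g)\<^sup>2"
    by (simp add: norm_power cmod_power2) (simp add: power2_eq_square)
  moreover have "(Re g)\<^sup>2 > (1 / 2)\<^sup>2" using * by (intro power_strict_mono) auto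
  ultimately show ?thesis by (simp add: g_def power_divide)
qed

text \<open>
  Here \<open>F = H + z H'\<close>, so \<open>H\<close> is the mean of \<open>F\<close> over radial segments.  The half-plane \<open>Re > 1/2\<close>
  corresponds to \<open>|v| < 1\<close> under \<open>v = 1 - 1 / H\<close>.  At a first point where \<open>Re H = 1/2\<close>, Jack's lemma for
  \<open>v\<close> gives \<open>F = H (k H - (k - 1))\<close>.  There \<open>|k H - (k - 1)| \<le> k |H|\<close> because \<open>k \<ge> 1\<close>, and
  \<open>Re F = 1/2 - k |H|\<^sup>2\<close>; so \<open>|F| + Re F \<le> 1/2\<close>, against the hypothesis on \<open>F\<close>.
\<close>

lemma mean_of_parabola_in_half_plane:
  fixes H F :: "complex \<Rightarrow> complex"
  assumes H: "H holomorphic_on unit_disc" "H 0 = 1"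
    and F: "\<And>z. z \<in> unit_disc \<Longrightarrow> ((\<lambda>w. w * H w) has_field_derivative F z) (at z)"
    and par: "\<And>z. z \<in> unit_disc \<Longrightarrow> cmod (F z) + Re (F z) > 1 / 2"
    and z: "z \<in> unit_disc"
  shows "Re (H z) > 1 / 2"
proof (rule ccontr)
  assume neg: "\<not> ?thesis"
  have "continuous_on unit_disc (\<lambda>z. - Re (H z))"
    using holomorphic_on_imp_continuous_on[OF H(1)] by (intro continuous_intros)
  then obtain z0 where z0: "z0 \<in> unit_disc" "- Re (H z0) = - 1/2"
      "\<And>z. cmod z < cmod z0 \<Longrightarrow> - Re (H z) < - 1/2"
    by (rule first_exit[of 1 "\<lambda>z. - Re (H z)" "- 1/2" z]) (use neg z H in auto)
  define v where "v = (\<lambda>z. 1 - 1 / H z)"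
  have v_lt: "cmod (v z) < 1" if "Re (H z) > 1 / 2" for z
  proof -
    have nz: "H z \<noteq> 0" using that by auto
    have "(cmod (H z - 1))\<^sup>2 < (cmod (H z))\<^sup>2"
      using that unfolding cmod_power2 by (simp add: power2_eq_square algebra_simps)
    then have "cmod (H z - 1) < cmod (H z)" by (simp add: power2_less_imp_less)
    moreover have "v z = (H z - 1) / H z" using nz by (simp add: v_def field_simps)
    ultimately show ?thesis using nz by (simp add: norm_divide)
  qed
  define h where "h = H z0"
  have hn: "h \<noteq> 0" and hre: "Re h = 1 / 2" using z0(2) by (auto simp: h_def)
  have v1: "cmod (v z0) = 1"
  proof -
    have "(cmod (h - 1))\<^sup>2 = (cmod h)\<^sup>2"
      using hre unfolding cmod_power2 by (simp add: power2_eq_square algebra_simps)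
    then have "cmod (h - 1) = cmod h" by simp
    moreover have "v z0 = (h - 1) / h" using hn by (simp add: v_def h_def field_simps)
    ultimately show ?thesis using hn by (simp add: norm_divide)
  qed
  define H' where "H' = deriv H z0"
  have H': "(H has_field_derivative H') (at z0)"
    unfolding H'_def using holomorphic_derivI[OF H(1) _ z0(1)] by auto
  have v': "(v has_field_derivative H' / h\<^sup>2) (at z0)"
    using DERIV_diff[OF DERIV_const DERIV_divide[OF DERIV_const H'], of 1 1] hn
    by (simp add: v_def h_def power2_eq_square)
  \<comment> \<open>On the whole disc \<open>H\<close> might vanish, but not before its real part has dropped to \<open>1/2\<close>.\<close>
  have holv: "v holomorphic_on ball 0 (cmod z0)"
  proof -
    have "H holomorphic_on ball 0 (cmod z0)" by (rule holomorphic_on_subset[OF H(1)]) (use z0 in auto)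
    moreover have "H z \<noteq> 0" if "z \<in> ball 0 (cmod z0)" for z using z0(3)[of z] that by auto
    ultimately show ?thesis unfolding v_def by (intro holomorphic_intros) auto
  qed
  obtain k :: real where k: "k \<ge> 1" "z0 * (H' / h\<^sup>2) = of_real k * v z0"
    by (rule Jack[OF holv _ _ v1 v']) (use z0(3) v_lt H in \<open>force simp: v_def\<close>)+
  have "((\<lambda>w. w * H w) has_field_derivative (h + z0 * H')) (at z0)"
    by (rule derivative_eq_intros H' | simp add: h_def)+
  with F[OF z0(1)] have "F z0 = h + z0 * H'" by (rule DERIV_unique)
  moreover have "z0 * H' = of_real k * v z0 * h\<^sup>2" using k(2) hn by (simp add: field_simps)
  moreover have "v z0 * h\<^sup>2 = h\<^sup>2 - h" using hn by (simp add: v_def h_def power2_eq_square field_simps)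
  ultimately have "F z0 = h + of_real k * (h\<^sup>2 - h)" by (simp only: mult.assoc)
  then have Fz: "F z0 = h * (of_real k * h - of_real (k - 1))"
    by (simp add: power2_eq_square algebra_simps)
  have "(cmod (of_real k * h - of_real (k - 1)))\<^sup>2 \<le> (k * cmod h)\<^sup>2"
    using hre k(1) unfolding power_mult_distrib cmod_power2 by (simp add: power2_eq_square algebra_simps)
  then have "cmod (of_real k * h - of_real (k - 1)) \<le> k * cmod h"
    by (rule power2_le_imp_le) (use k(1) in simp)
  from mult_left_mono[OF this norm_ge_zero[of h]] have "cmod (F z0) \<le> k * (cmod h)\<^sup>2"
    unfolding Fz norm_mult by (simp only: power2_eq_square mult_ac)
  moreover have "Re (F z0) = 1 / 2 - k * (cmod h)\<^sup>2"
    unfolding Fz using hre by (simp add: cmod_power2) (simp add: power2_eq_square field_simps)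
  ultimately show False using par[OF z0(1)] by simp
qed

text \<open>
  Here \<open>H(z)\<close> is the primitive of \<open>f(z) / z\<close> that vanishes at \<open>0\<close>, divided by \<open>z\<close>.
\<close>

lemma class_U_half_plane_mean:
  assumes f: "f \<in> class_U"
  obtains H where "H holomorphic_on unit_disc" "H 0 = 1"
    "\<And>z. z \<in> unit_disc \<Longrightarrow> Re (H z) > 1 / 2"
    "\<And>z. z \<in> unit_disc \<Longrightarrow> f z = z * deriv (\<lambda>w. w * H w) z"
proof -
  obtain q where q: "q holomorphic_on unit_disc" "q 0 = 1" "\<And>z. z \<in> unit_disc \<Longrightarrow> q z \<noteq> 0"
    "\<And>z. z \<in> unit_disc \<Longrightarrow> f z = z / (q z)\<^sup>2" "\<And>z. z \<in> unit_disc \<Longrightarrow> id_over f z = (q z)\<^sup>2"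
    using class_U_root[OF f] by blast
  define F where "F = (\<lambda>z. 1 / (q z)\<^sup>2)"
  have "F holomorphic_on unit_disc" unfolding F_def using q by (intro holomorphic_intros) auto
  then obtain \<Phi> where "\<And>z. z \<in> unit_disc \<Longrightarrow> (\<Phi> has_field_derivative F z) (at z within unit_disc)"
    using holomorphic_convex_primitive'[OF convex_ball open_ball] by blast
  then have \<Phi>: "(\<Phi> has_field_derivative F z) (at z)" if "z \<in> unit_disc" for z
    using that by (metis at_within_open open_ball)
  define H where "H z = (if z = 0 then deriv \<Phi> 0 else (\<Phi> z - \<Phi> 0) / (z - 0))" for z
  have "\<Phi> holomorphic_on unit_disc"
    using \<Phi> unfolding holomorphic_on_open[OF open_ball] by blast
  then have H: "H holomorphic_on unit_disc" unfolding H_def by (rule pole_lemma) auto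
  have H0: "H 0 = 1" using DERIV_imp_deriv[OF \<Phi>[of 0]] q by (simp add: H_def F_def)
  have eq: "(\<lambda>w. w * H w) = (\<lambda>w. \<Phi> w - \<Phi> 0)" by (auto simp: H_def)
  have der: "((\<lambda>w. w * H w) has_field_derivative F z) (at z)" if "z \<in> unit_disc" for z
    unfolding eq by (rule derivative_eq_intros \<Phi> that | simp)+
  show thesis
  proof (rule that[OF H H0])
    fix z assume z: "z \<in> unit_disc"
    have "cmod (F w) + Re (F w) > 1 / 2" if "w \<in> unit_disc" for w
      unfolding F_def by (intro inverse_square_in_parabola class_U_root_bound[OF f q] q(3) that)
    then show "Re (H z) > 1 / 2"
      using mean_of_parabola_in_half_plane[OF H H0 der _ z] by blast
    show "f z = z * deriv (\<lambda>w. w * H w) z"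
      using q(4)[OF z] DERIV_imp_deriv[OF der[OF z]] by (simp add: F_def)
  qed
qed

section \<open>Herglotz representation\<close>

lemma has_integral_circle_mean:
  fixes g :: "complex \<Rightarrow> complex"
  assumes g: "g holomorphic_on cball 0 \<rho>" and \<rho>: "\<rho> > 0"
  shows "((\<lambda>t. g (of_real \<rho> * cis t)) has_integral (2 * pi * g 0)) {0..2 * pi}"
proof -
  have "((\<lambda>u. g u / (u - 0)) has_contour_integral (2 * of_real pi * \<i> * g 0)) (circlepath 0 \<rho>)"
    using \<rho> by (intro Cauchy_integral_circlepath_simple g) auto
  then have "((\<lambda>t. g (of_real \<rho> * cis t) / (of_real \<rho> * cis t) * of_real \<rho> * \<i> * cis t)
      has_integral (2 * of_real pi * \<i> * g 0)) {0..2 * pi}"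
    unfolding circlepath_def by (subst (asm) has_contour_integral_part_circlepath_iff) auto
  from has_integral_mult_right[OF this, of "- \<i>"] show ?thesis
    using \<rho> by (simp add: mult_ac)
qed

text \<open>
  Cauchy's formula for the derivative of \<open>w H(w)\<close> at \<open>\<rho> z\<close>: on the circle \<open>u = \<rho> cis t\<close> the kernel
  \<open>u / (u - \<rho> z)\<^sup>2 du\<close> is \<open>\<i> dt / (1 - cis (-t) z)\<^sup>2\<close>.
\<close>

lemma has_integral_circle_deriv:
  fixes H :: "complex \<Rightarrow> complex"
  assumes H: "H holomorphic_on cball 0 \<rho>" and \<rho>: "\<rho> > 0" and z: "cmod z < 1"
  shows "((\<lambda>t. H (of_real \<rho> * cis t) / (1 - cis (- t) * z)\<^sup>2)
           has_integral (2 * pi * deriv (\<lambda>w. w * H w) (of_real \<rho> * z))) {0..2 * pi}"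
proof -
  define \<Phi> where "\<Phi> = (\<lambda>w. w * H w)"
  have \<Phi>: "\<Phi> holomorphic_on cball 0 \<rho>" unfolding \<Phi>_def by (intro holomorphic_intros H)
  define w where "w = of_real \<rho> * z"
  have w: "w \<in> ball 0 \<rho>" using \<rho> z by (simp add: w_def norm_mult)
  define I where "I = contour_integral (circlepath 0 \<rho>) (\<lambda>u. \<Phi> u / (u - w)\<^sup>2)"
  have "continuous_on (cball 0 \<rho>) \<Phi>" "\<Phi> holomorphic_on ball 0 \<rho>"
    using \<Phi> by (auto intro: holomorphic_on_imp_continuous_on holomorphic_on_subset)
  note C = Cauchy_derivative_integral_circlepath[OF this w, folded I_def]
  have "((\<lambda>u. \<Phi> u / (u - w)\<^sup>2) has_contour_integral I) (circlepath 0 \<rho>)"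
    using C(1) unfolding I_def by (rule has_contour_integral_integral)
  moreover have "I = 2 * of_real pi * \<i> * deriv \<Phi> w"
    using DERIV_imp_deriv[OF C(2)] by (simp add: field_simps)
  ultimately have *: "((\<lambda>t. \<Phi> (of_real \<rho> * cis t) / (of_real \<rho> * cis t - w)\<^sup>2 * of_real \<rho> * \<i> * cis t)
      has_integral (2 * of_real pi * \<i> * deriv \<Phi> w)) {0..2 * pi}"
    unfolding circlepath_def by (subst (asm) has_contour_integral_part_circlepath_iff) auto
  have eq: "- \<i> * (\<Phi> (of_real \<rho> * cis t) / (of_real \<rho> * cis t - w)\<^sup>2 * of_real \<rho> * \<i> * cis t)
      = H (of_real \<rho> * cis t) / (1 - cis (- t) * z)\<^sup>2" for t
  proof -
    have cc: "cis t * cis (- t) = 1" by (simp add: cis_mult)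
    have "of_real \<rho> * cis t - w = of_real \<rho> * cis t * (1 - cis (- t) * z)"
      using cc by (simp add: w_def right_diff_distrib mult.assoc)
    then have sq: "(of_real \<rho> * cis t - w)\<^sup>2 = (of_real \<rho> * cis t)\<^sup>2 * (1 - cis (- t) * z)\<^sup>2"
      by (simp add: power_mult_distrib)
    have "- \<i> * (\<Phi> (of_real \<rho> * cis t) / (of_real \<rho> * cis t - w)\<^sup>2 * of_real \<rho> * \<i> * cis t)
      = ((of_real \<rho> * cis t)\<^sup>2 * H (of_real \<rho> * cis t)) / (of_real \<rho> * cis t - w)\<^sup>2"
      by (simp add: \<Phi>_def power2_eq_square mult_ac)
    also have "\<dots> = H (of_real \<rho> * cis t) / (1 - cis (- t) * z)\<^sup>2"
      unfolding sq using \<rho> by (subst mult_divide_mult_cancel_left) auto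
    finally show ?thesis .
  qed
  from has_integral_mult_right[OF *, of "- \<i>"] show ?thesis
    unfolding eq by (simp add: \<Phi>_def w_def mult_ac)
qed

text \<open>
  The conjugate of the integrand is the boundary value of \<open>H(u) / (1 - u cnj z / \<rho>)\<^sup>2\<close>, which is
  holomorphic on the closed disc, so the mean value property applies.
\<close>

lemma has_integral_circle_cnj:
  fixes H :: "complex \<Rightarrow> complex"
  assumes H: "H holomorphic_on cball 0 \<rho>" and \<rho>: "\<rho> > 0" and z: "cmod z < 1"
  shows "((\<lambda>t. cnj (H (of_real \<rho> * cis t)) / (1 - cis (- t) * z)\<^sup>2)
           has_integral (2 * pi * cnj (H 0))) {0..2 * pi}"
proof -
  define g where "g u = H u / (1 - u / of_real \<rho> * cnj z)\<^sup>2" for u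
  have "1 - u / of_real \<rho> * cnj z \<noteq> 0" if "u \<in> cball 0 \<rho>" for u
  proof
    assume "1 - u / of_real \<rho> * cnj z = 0"
    then have "cmod (u / of_real \<rho> * cnj z) = 1" by (metis eq_iff_diff_eq_0 norm_one)
    moreover have "cmod (u / of_real \<rho> * cnj z) = cmod u / \<rho> * cmod z"
      using \<rho> by (simp add: norm_mult norm_divide)
    moreover have "cmod u / \<rho> * cmod z \<le> 1 * cmod z" using that \<rho> by (intro mult_right_mono) auto
    ultimately show False using z by linarith
  qed
  then have "g holomorphic_on cball 0 \<rho>" unfolding g_def by (intro holomorphic_intros H) auto
  from has_integral_circle_mean[OF this \<rho>]
  have "((\<lambda>t. g (of_real \<rho> * cis t)) has_integral (2 * pi * H 0)) {0..2 * pi}"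
    by (simp add: g_def)
  then have "(cnj \<circ> (\<lambda>t. g (of_real \<rho> * cis t)) has_integral cnj (2 * pi * H 0)) {0..2 * pi}"
    by (simp only: has_integral_cnj)
  then show ?thesis using \<rho> by (simp add: g_def o_def cis_cnj)
qed

text \<open>
  Write \<open>2 Re H - 1 = H + cnj H - 1\<close>.  The first term contributes the derivative, while the other two
  contribute \<open>1\<close> and \<open>-1\<close> (times \<open>2\<pi>\<close>), the last one by the same formula for the constant function \<open>1\<close>.
\<close>

lemma has_integral_circle_density:
  fixes H :: "complex \<Rightarrow> complex"
  assumes H: "H holomorphic_on cball 0 \<rho>" "H 0 = 1" and \<rho>: "\<rho> > 0" and z: "cmod z < 1"
  shows "((\<lambda>t. ((2 * Re (H (of_real \<rho> * cis t)) - 1) / (2 * pi)) *\<^sub>R (1 / (1 - cis (- t) * z)\<^sup>2))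
           has_integral deriv (\<lambda>w. w * H w) (of_real \<rho> * z)) {0..2 * pi}"
proof -
  let ?k = "\<lambda>t. (1 - cis (- t) * z)\<^sup>2"
  let ?D = "deriv (\<lambda>w. w * H w) (of_real \<rho> * z)"
  have "((\<lambda>t. H (of_real \<rho> * cis t) / ?k t + cnj (H (of_real \<rho> * cis t)) / ?k t - 1 / ?k t)
      has_integral (2 * pi * ?D + 2 * pi * cnj (H 0) - 2 * pi * deriv (\<lambda>w. w * 1) (of_real \<rho> * z)))
      {0..2 * pi}"
    using has_integral_circle_deriv[OF H(1) \<rho> z] has_integral_circle_cnj[OF H(1) \<rho> z]
      has_integral_circle_deriv[of "\<lambda>_. 1", OF holomorphic_on_const \<rho> z]
    by (intro has_integral_diff has_integral_add)
  then have "((\<lambda>t. H (of_real \<rho> * cis t) / ?k t + cnj (H (of_real \<rho> * cis t)) / ?k t - 1 / ?k t)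
      has_integral (2 * pi * ?D)) {0..2 * pi}"
    using H by simp
  from has_integral_mult_right[OF this, of "1 / (2 * pi)"]
  have "((\<lambda>t. 1 / (2 * pi) * (H (of_real \<rho> * cis t) / ?k t + cnj (H (of_real \<rho> * cis t)) / ?k t - 1 / ?k t))
      has_integral ?D) {0..2 * pi}" by simp
  moreover have "1 / (2 * pi) * (w / k + cnj w / k - 1 / k) = ((2 * Re w - 1) / (2 * pi)) *\<^sub>R (1 / k)"
    for w k
  proof -
    have "w / k + cnj w / k - 1 / k = (w + cnj w - 1) / k"
      by (simp add: add_divide_distrib diff_divide_distrib)
    also have "\<dots> = of_real (2 * Re w - 1) / k" unfolding complex_add_cnj by simp
    finally have "w / k + cnj w / k - 1 / k = of_real (2 * Re w - 1) / k" .
    then show ?thesis by (simp add: scaleR_conv_of_real)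
  qed
  ultimately show ?thesis by simp
qed

text \<open>
  Cauchy's formulas yield gauge integrals over an interval, whereas Helly's theorem speaks of distributions
  on the line; this passes from the former to the latter.
\<close>

lemma density_on_interval:
  fixes h :: "real \<Rightarrow> real"
  assumes h: "continuous_on {a..b} h" "\<And>t. t \<in> {a..b} \<Longrightarrow> h t \<ge> 0" "(h has_integral 1) {a..b}"
  defines "\<mu> \<equiv> density lborel (\<lambda>t. indicator {a..b} t * h t)"
  shows "real_distribution \<mu>" "measure \<mu> {a..b} = 1"
    and "\<And>f :: real \<Rightarrow> complex. \<And>J. continuous_on UNIV f \<Longrightarrow>
          ((\<lambda>t. h t *\<^sub>R f t) has_integral J) {a..b} \<Longrightarrow> integral\<^sup>L \<mu> f = J"
proof -
  let ?d = "\<lambda>t. indicator {a..b} t * h t"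
  have int: "integrable lborel ?d"
    using borel_integrable_compact[OF compact_Icc h(1)] by simp
  have nonneg: "?d t \<ge> 0" for t using h(2) by (auto simp: indicator_def)
  have meas[measurable]: "?d \<in> borel_measurable lborel" using int by (rule borel_measurable_integrable)
  have one: "integral\<^sup>L lborel ?d = 1"
  proof -
    have "(?d has_integral integral\<^sup>L lborel ?d) UNIV" by (rule has_integral_integral_lborel[OF int])
    moreover have "?d = (\<lambda>t. if t \<in> {a..b} then h t else 0)" by (auto simp: indicator_def)
    ultimately have "(h has_integral integral\<^sup>L lborel ?d) {a..b}"
      by (simp only: has_integral_restrict_UNIV)
    then show ?thesis using h(3) by (rule has_integral_unique)
  qed
  have ind: "emeasure \<mu> A = 1" if "A \<in> sets borel" "{a..b} \<subseteq> A" for A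
  proof -
    have "emeasure \<mu> A = (\<integral>\<^sup>+t. ennreal (?d t) * indicator A t \<partial>lborel)"
      unfolding \<mu>_def using that by (subst emeasure_density) auto
    also have "\<dots> = (\<integral>\<^sup>+t. ennreal (?d t) \<partial>lborel)"
      using that by (intro nn_integral_cong) (auto simp: indicator_def)
    also have "\<dots> = 1"
      using nn_integral_eq_integral[OF int] nonneg one by simp
    finally show ?thesis .
  qed
  have "prob_space \<mu>" by (rule prob_spaceI) (use ind[of UNIV] in \<open>simp add: \<mu>_def\<close>)
  then interpret prob_space \<mu> .
  show "real_distribution \<mu>" by standard (simp add: \<mu>_def)
  show "measure \<mu> {a..b} = 1" using ind[of "{a..b}"] by (simp add: measure_def)
  fix f :: "real \<Rightarrow> complex" and J
  assume f: "continuous_on UNIV f" and J: "((\<lambda>t. h t *\<^sub>R f t) has_integral J) {a..b}"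
  have [measurable]: "f \<in> borel_measurable borel" using f by (rule borel_measurable_continuous_onI)
  have "continuous_on {a..b} (\<lambda>t. h t *\<^sub>R f t)"
    by (intro continuous_intros h continuous_on_subset[OF f]) auto
  then have i: "integrable lborel (\<lambda>t. indicator {a..b} t *\<^sub>R (h t *\<^sub>R f t))"
    by (rule borel_integrable_compact[OF compact_Icc])
  have "integral\<^sup>L \<mu> f = integral\<^sup>L lborel (\<lambda>t. ?d t *\<^sub>R f t)"
    unfolding \<mu>_def using nonneg by (intro integral_density) auto
  also have "\<dots> = integral\<^sup>L lborel (\<lambda>t. indicator {a..b} t *\<^sub>R (h t *\<^sub>R f t))" by simp
  also have "\<dots> = J"
  proof -
    have "(\<lambda>t. indicator {a..b} t *\<^sub>R (h t *\<^sub>R f t)) = (\<lambda>t. if t \<in> {a..b} then h t *\<^sub>R f t else 0)"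
      by (auto simp: indicator_def)
    with has_integral_integral_lborel[OF i]
    have "((\<lambda>t. h t *\<^sub>R f t) has_integral
        integral\<^sup>L lborel (\<lambda>t. indicator {a..b} t *\<^sub>R (h t *\<^sub>R f t))) {a..b}"
      by (simp only: has_integral_restrict_UNIV)
    then show ?thesis using J by (rule has_integral_unique)
  qed
  finally show "integral\<^sup>L \<mu> f = J" .
qed

lemma one_minus_circle_mult_ne_0:
  fixes x z :: complex
  assumes "cmod x = 1" "cmod z < 1"
  shows "1 - x * z \<noteq> 0"
  using assms by (metis eq_iff_diff_eq_0 mult_1 norm_mult norm_one order_less_irrefl)

lemma koebe_kernel_bound:
  assumes "cmod x = 1" "cmod z < 1"
  shows "cmod (1 / (1 - x * z)\<^sup>2) \<le> 1 / (1 - cmod z)\<^sup>2"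
proof -
  have "1 - cmod z \<le> cmod (1 - x * z)"
    using norm_triangle_ineq2[of 1 "x * z"] assms by (simp add: norm_mult)
  then have "(1 - cmod z)\<^sup>2 \<le> (cmod (1 - x * z))\<^sup>2"
    using assms by (intro power_mono) auto
  then show ?thesis using assms by (simp add: norm_divide norm_power frac_le)
qed

text \<open>
  On the circle of radius \<open>\<rho> < 1\<close> the function \<open>(2 Re H - 1) / 2\<pi>\<close> is a probability density on
  \<open>[0, 2\<pi>]\<close>, and \<open>has_integral_circle_density\<close> represents \<open>z \<mapsto> (w H)'(\<rho> z)\<close> by it.  As \<open>\<rho>\<close> tends to \<open>1\<close>,
  Helly's theorem yields a weak limit on the line, and its image under \<open>t \<mapsto> cis (-t)\<close> is the required
  measure.
\<close>

lemma half_plane_representation: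
  fixes H :: "complex \<Rightarrow> complex"
  assumes H: "H holomorphic_on unit_disc" "H 0 = 1"
    and re: "\<And>z. z \<in> unit_disc \<Longrightarrow> Re (H z) > 1 / 2"
  obtains \<mu> where "circle_prob_measure \<mu>"
    "\<And>z. z \<in> unit_disc \<Longrightarrow> deriv (\<lambda>w. w * H w) z = (LINT x|\<mu>. 1 / (1 - x * z)\<^sup>2)"
proof -
  define D where "D = deriv (\<lambda>w. w * H w)"
  have D: "continuous_on unit_disc D"
    unfolding D_def by (intro holomorphic_on_imp_continuous_on holomorphic_deriv holomorphic_intros H) auto
  define \<rho> where "\<rho> n = 1 - inverse (real (Suc (Suc n)))" for n
  have \<rho>: "0 < \<rho> n" "\<rho> n < 1" for n by (auto simp: \<rho>_def field_simps)
  have sub: "cball 0 (\<rho> n) \<subseteq> unit_disc" for n using \<rho>[of n] by auto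
  have lim\<rho>: "\<rho> \<longlonglongrightarrow> 1"
    using tendsto_diff[OF tendsto_const LIMSEQ_Suc[OF LIMSEQ_inverse_real_of_nat], of 1]
    by (simp add: \<rho>_def[abs_def])
  define h where "h n t = (2 * Re (H (of_real (\<rho> n) * cis t)) - 1) / (2 * pi)" for n t
  define M where "M n = density lborel (\<lambda>t. indicator {0..2*pi} t * h n t)" for n
  have Hn: "H holomorphic_on cball 0 (\<rho> n)" for n by (rule holomorphic_on_subset[OF H(1) sub])
  have circ: "of_real (\<rho> n) * cis t \<in> unit_disc" for n t
    using \<rho>[of n] by (simp add: norm_mult)
  have h_cont: "continuous_on {0..2*pi} (h n)" for n
    unfolding h_def
    by (intro continuous_intros continuous_on_compose2[OF holomorphic_on_imp_continuous_on[OF H(1)]])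
      (use circ in auto)
  have h_nonneg: "h n t \<ge> 0" for n t using re[OF circ[of n t]] by (simp add: h_def)
  have h_int: "((\<lambda>t. h n t *\<^sub>R (1 / (1 - cis (- t) * z)\<^sup>2)) has_integral D (of_real (\<rho> n) * z)) {0..2*pi}"
    if "cmod z < 1" for n z
    unfolding h_def D_def by (rule has_integral_circle_density[OF Hn H(2) \<rho>(1) that])
  have D0: "D 0 = 1"
  proof -
    have "(H has_field_derivative deriv H 0) (at 0)" using holomorphic_derivI[OF H(1), of 0] by simp
    then have "((\<lambda>w. w * H w) has_field_derivative H 0) (at 0)"
      by (auto intro!: derivative_eq_intros)
    then show ?thesis using H(2) by (simp add: D_def DERIV_imp_deriv)
  qed
  \<comment> \<open>The representation at \<open>z = 0\<close> says that the total mass is \<open>1\<close>.\<close>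
  have h_one: "(h n has_integral 1) {0..2*pi}" for n
    using has_integral_linear[OF h_int[of 0 n] bounded_linear_Re] D0 by (simp add: o_def)
  note M = density_on_interval[OF h_cont h_nonneg h_one, folded M_def]
  have "tight M"
    unfolding tight_def
  proof (intro conjI allI impI)
    show "real_distribution (M n)" for n by (rule M)
    fix \<epsilon> :: real assume "\<epsilon> > 0"
    have "measure (M n) {-1<..2*pi} > 1 - \<epsilon>" for n
    proof -
      interpret real_distribution "M n" by (rule M)
      have "measure (M n) {0..2*pi} \<le> measure (M n) {-1<..2*pi}"
        by (intro finite_measure_mono) auto
      then show ?thesis using M(2)[of n] \<open>\<epsilon> > 0\<close> by simp
    qed
    then show "\<exists>a b. a < b \<and> (\<forall>n. 1 - \<epsilon> < measure (M n) {a<..b})"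
      using pi_gt_zero by (intro exI[of _ "-1"] exI[of _ "2*pi"]) (auto intro: less_trans[of _ 0])
  qed
  from tight_imp_convergent_subsubsequence[OF this strict_mono_id]
  obtain r N where r: "strict_mono r" and N: "real_distribution N" and weak: "weak_conv_m (M \<circ> r) N"
    by auto
  interpret N: real_distribution N by (rule N)
  have repr: "D z = (LINT t|N. 1 / (1 - cis (- t) * z)\<^sup>2)" if z: "cmod z < 1" for z
  proof -
    let ?k = "\<lambda>t. 1 / (1 - cis (- t) * z)\<^sup>2"
    have kc: "continuous_on UNIV ?k"
      using one_minus_circle_mult_ne_0[of "cis _" z] z by (intro continuous_intros) auto
    have "(\<lambda>n. integral\<^sup>L ((M \<circ> r) n) ?k) \<longlonglongrightarrow> integral\<^sup>L N ?k"
    proof (rule weak_conv_imp_integral_bdd_continuous_conv)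
      show "isCont ?k t" for t using kc by (simp add: continuous_on_eq_continuous_at)
      show "cmod (?k t) \<le> 1 / (1 - cmod z)\<^sup>2" for t by (rule koebe_kernel_bound) (use z in auto)
    qed (use M(1) N weak in \<open>simp_all add: o_def\<close>)
    moreover have "integral\<^sup>L ((M \<circ> r) n) ?k = D (of_real (\<rho> (r n)) * z)" for n
      using M(3)[OF kc h_int[OF z]] by simp
    moreover have "(\<lambda>n. D (of_real (\<rho> (r n)) * z)) \<longlonglongrightarrow> D z"
    proof (rule continuous_on_tendsto_compose[OF D])
      have "(\<lambda>n. \<rho> (r n)) \<longlonglongrightarrow> 1" using LIMSEQ_subseq_LIMSEQ[OF lim\<rho> r] by (simp add: o_def)
      then have "(\<lambda>n. of_real (\<rho> (r n)) * z) \<longlonglongrightarrow> of_real 1 * z" by (intro tendsto_intros)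
      then show "(\<lambda>n. of_real (\<rho> (r n)) * z) \<longlonglongrightarrow> z" by simp
      have "cmod (of_real (\<rho> (r n)) * z) < 1" for n
      proof -
        have "\<rho> (r n) * cmod z \<le> 1 * cmod z" using \<rho>[of "r n"] by (intro mult_right_mono) auto
        then show ?thesis using z \<rho>[of "r n"] by (simp add: norm_mult)
      qed
      then show "\<forall>\<^sub>F n in sequentially. of_real (\<rho> (r n)) * z \<in> unit_disc" by simp
    qed (use z in auto)
    ultimately show ?thesis by (simp add: LIMSEQ_unique)
  qed
  define S where "S = restrict_space borel (sphere (0 :: complex) 1)"
  have cm: "(\<lambda>t. cis (- t)) \<in> measurable N S"
    unfolding S_def
  proof (rule measurable_restrict_space2)
    have "(\<lambda>t :: real. cis (- t)) \<in> borel_measurable borel"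
      by (intro borel_measurable_continuous_onI continuous_intros)
    then show "(\<lambda>t. cis (- t)) \<in> borel_measurable N"
      using measurable_cong_sets[OF N.events_eq_borel refl] by blast
  qed auto
  show thesis
  proof (rule that[of "distr N S (\<lambda>t. cis (- t))"])
    show "circle_prob_measure (distr N S (\<lambda>t. cis (- t)))"
      unfolding circle_prob_measure_def using N.prob_space_distr[OF cm] by (simp add: S_def)
    fix z assume "z \<in> unit_disc"
    moreover have "(\<lambda>x. 1 / (1 - x * z)\<^sup>2) \<in> borel_measurable S"
      unfolding S_def by (intro measurable_restrict_space1) measurable
    ultimately show "deriv (\<lambda>w. w * H w) z
        = (LINT x|distr N S (\<lambda>t. cis (- t)). 1 / (1 - x * z)\<^sup>2)"
      using repr[of z] by (simp add: integral_distr[OF cm] D_def)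
  qed
qed

section \<open>The closed convex hull of the starlike functions\<close>

text \<open>
  The rotated Koebe functions, continued by \<open>0\<close> off the disc as members of \<^const>\<open>disc_analytic\<close> must be.
\<close>

definition koebe :: "complex \<Rightarrow> complex \<Rightarrow> complex" where
  "koebe x z = (if z \<in> unit_disc then z / (1 - x * z)\<^sup>2 else 0)"

lemma koebe_class_A:
  assumes x: "cmod x = 1"
  shows "koebe x \<in> class_A"
proof (rule class_AI)
  have "(\<lambda>z. z / (1 - x * z)\<^sup>2) holomorphic_on unit_disc"
    using one_minus_circle_mult_ne_0[OF x] by (intro holomorphic_intros) auto
  then have "koebe x holomorphic_on unit_disc"
    by (rule holomorphic_transform) (simp add: koebe_def)
  then show "koebe x \<in> disc_analytic"
    unfolding disc_analytic_def by (simp add: koebe_def)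
  show "koebe x 0 = 0" by (simp add: koebe_def)
  have "((\<lambda>z. z / (1 - x * z)\<^sup>2) has_field_derivative 1) (at 0)"
    by (auto intro!: derivative_eq_intros)
  then have "(koebe x has_field_derivative 1) (at 0)"
    by (rule has_field_derivative_transform_within_open[of _ _ _ unit_disc]) (auto simp: koebe_def)
  then show "deriv (koebe x) 0 = 1" by (rule DERIV_imp_deriv)
qed

lemma koebe_inj:
  assumes x: "cmod x = 1"
  shows "inj_on (koebe x) unit_disc"
proof (rule inj_onI)
  fix z w assume zw: "z \<in> unit_disc" "w \<in> unit_disc" "koebe x z = koebe x w"
  have nz: "1 - x * z \<noteq> 0" "1 - x * w \<noteq> 0" using one_minus_circle_mult_ne_0[OF x] zw by auto
  have "z * (1 - x * w)\<^sup>2 = w * (1 - x * z)\<^sup>2"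
    using zw nz by (simp add: koebe_def frac_eq_eq)
  \<comment> \<open>Clearing denominators leaves the factor \<open>1 - x\<^sup>2 z w\<close>, which has no zero in the disc.\<close>
  then have "(z - w) * (1 - x * (x * z * w)) = 0" by (simp add: power2_eq_square algebra_simps)
  moreover have "1 - x * (x * z * w) \<noteq> 0"
  proof (rule one_minus_circle_mult_ne_0[OF x])
    have "cmod z * cmod w \<le> cmod z * 1" using zw by (intro mult_left_mono) auto
    then show "cmod (x * z * w) < 1" using zw x by (simp add: norm_mult)
  qed
  ultimately show "z = w" by simp
qed

text \<open>
  With \<open>s = (1 + x z) / (1 - x z)\<close>, a bijection of the disc onto the right half-plane, the value at \<open>z\<close> is
  \<open>(s\<^sup>2 - 1) / (4 x)\<close>.  Shrinking it by the factor \<open>t\<close> replaces \<open>s\<^sup>2\<close> by \<open>W = 1 + t (s\<^sup>2 - 1)\<close>.  Squares of the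
  right half-plane fill the plane slit along the nonpositive reals, which is starlike with respect to \<open>1\<close>;
  so \<open>W\<close> has a square root \<open>\<sigma>\<close> with positive real part, and the preimage of \<open>\<sigma>\<close> in the disc is the
  point sought.
\<close>

lemma koebe_starlike:
  assumes x: "cmod x = 1"
  shows "koebe x \<in> starlike_functions"
proof -
  have x0: "x \<noteq> 0" using x by auto
  have "of_real t * koebe x z \<in> koebe x ` unit_disc" if z: "z \<in> unit_disc" and t: "0 \<le> t" "t \<le> 1" for z t
  proof -
    define s where "s = (1 + x * z) / (1 - x * z)"
    have nz: "1 - x * z \<noteq> 0" using one_minus_circle_mult_ne_0[OF x] z by auto
    have s2: "s\<^sup>2 - 1 = 4 * x * koebe x z"
      using z nz by (simp add: s_def koebe_def power_divide field_simps) (simp add: power2_eq_square algebra_simps)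
    have s_re: "Re s > 0"
    proof -
      have "s + 1 = 2 / (1 - x * z)" using nz by (simp add: s_def field_simps)
      moreover have "s - 1 = 2 * (x * z) / (1 - x * z)" using nz by (simp add: s_def field_simps)
      moreover have "cmod (x * z) < 1" using x z by (simp add: norm_mult)
      ultimately have "cmod (s - 1) < cmod (s + 1)"
        using nz by (simp add: norm_divide norm_mult divide_strict_right_mono)
      then have "(cmod (s - 1))\<^sup>2 < (cmod (s + 1))\<^sup>2" by (intro power_strict_mono) auto
      then show ?thesis unfolding cmod_power2 by (simp add: power2_eq_square algebra_simps)
    qed
    define W where "W = 1 + of_real t * (s\<^sup>2 - 1)"
    define \<sigma> where "\<sigma> = csqrt W"
    have \<sigma>2: "\<sigma>\<^sup>2 = W" by (simp add: \<sigma>_def)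
    have W: "W \<notin> \<real>\<^sub>\<le>\<^sub>0"
    proof
      assume "W \<in> \<real>\<^sub>\<le>\<^sub>0"
      then have im: "Im W = 0" and re: "Re W \<le> 0" by (auto simp: complex_nonpos_Reals_iff)
      from im have "t = 0 \<or> Im s = 0" using s_re by (auto simp: W_def power2_eq_square)
      then have "Re W = (1 - t) + t * (Re s)\<^sup>2" by (auto simp: W_def power2_eq_square algebra_simps)
      moreover have "(1 - t) + t * (Re s)\<^sup>2 > 0"
      proof (cases "t = 0")
        case False
        then have "t * (Re s)\<^sup>2 > 0" using t s_re by auto
        then show ?thesis using t by linarith
      qed simp
      ultimately show False using re by simp
    qed
    have \<sigma>_re: "Re \<sigma> > 0"
    proof (rule ccontr)
      assume "\<not> Re \<sigma> > 0"
      then have "Re \<sigma> = 0" using csqrt_principal[of W] by (simp add: \<sigma>_def)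
      then have "Re W = - (Im \<sigma>)\<^sup>2" "Im W = 0" by (simp_all add: power2_eq_square flip: \<sigma>2)
      then show False using W by (simp add: complex_nonpos_Reals_iff)
    qed
    have "Re (\<sigma> + 1) \<noteq> 0" using \<sigma>_re by simp
    then have n1: "\<sigma> + 1 \<noteq> 0" by force
    define z' where "z' = (\<sigma> - 1) / (x * (\<sigma> + 1))"
    have "(cmod (\<sigma> - 1))\<^sup>2 < (cmod (\<sigma> + 1))\<^sup>2"
      using \<sigma>_re unfolding cmod_power2 by (simp add: power2_eq_square algebra_simps)
    then have "cmod (\<sigma> - 1) < cmod (\<sigma> + 1)" by (rule power2_less_imp_less) simp
    then have z': "z' \<in> unit_disc" using n1 x by (simp add: z'_def norm_divide norm_mult)
    have "x * z' = (\<sigma> - 1) / (\<sigma> + 1)" using x0 by (simp add: z'_def)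
    then have "1 - x * z' = 2 / (\<sigma> + 1)" using n1 by (simp add: field_simps)
    then have "koebe x z' = z' * (\<sigma> + 1)\<^sup>2 / 4" using z' by (simp add: koebe_def power_divide)
    also have "\<dots> = (\<sigma> - 1) * (\<sigma> + 1) / (4 * x)"
      using n1 x0 by (simp add: z'_def power2_eq_square)
    also have "(\<sigma> - 1) * (\<sigma> + 1) = of_real t * (s\<^sup>2 - 1)"
      using \<sigma>2 by (simp add: W_def power2_eq_square algebra_simps)
    also have "\<dots> / (4 * x) = of_real t * koebe x z" unfolding s2 using x0 by simp
    finally show ?thesis using z' by (metis imageI)
  qed
  then have "closed_segment 0 w \<subseteq> koebe x ` unit_disc" if "w \<in> koebe x ` unit_disc" for w
    using that by (auto simp: closed_segment_def scaleR_conv_of_real)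
  with koebe_class_A[OF x] koebe_inj[OF x] show ?thesis by (auto simp: starlike_functions_def)
qed

text \<open>
  The sets that generate the topology are centred at arbitrary functions.  If such a set contains \<open>f\<close>,
  compactness of \<open>K\<close> leaves some room below \<open>\<epsilon>\<close>, so it contains a set of the same kind centred at \<open>f\<close>.
\<close>

lemma disc_topology_nbhd_base:
  assumes "openin disc_topology T" "f \<in> T"
  obtains K \<epsilon> where "compact K" "K \<subseteq> unit_disc" "\<epsilon> > 0" "disc_nbhd f K \<epsilon> \<subseteq> T"
proof -
  let ?B = "{disc_nbhd f K \<epsilon> | f K \<epsilon>. f \<in> disc_analytic \<and> compact K \<and> K \<subseteq> unit_disc \<and> \<epsilon> > 0}"
  have "generate_topology_on ?B T"
    using assms(1) unfolding disc_topology_def by (rule openin_topology_generated_by)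
  then have "\<exists>K \<epsilon>. compact K \<and> K \<subseteq> unit_disc \<and> \<epsilon> > 0 \<and> disc_nbhd f K \<epsilon> \<subseteq> T"
    using assms(2)
  proof induction
    case Empty
    then show ?case by simp
  next
    case (Int a b)
    then obtain K \<epsilon> L \<delta> where "compact K" "K \<subseteq> unit_disc" "\<epsilon> > 0" "disc_nbhd f K \<epsilon> \<subseteq> a"
      "compact L" "L \<subseteq> unit_disc" "\<delta> > 0" "disc_nbhd f L \<delta> \<subseteq> b" by blast
    moreover from this have "disc_nbhd f (K \<union> L) (min \<epsilon> \<delta>) \<subseteq> a \<inter> b"
      by (fastforce simp: disc_nbhd_def)
    ultimately show ?case
      by (intro exI[of _ "K \<union> L"] exI[of _ "min \<epsilon> \<delta>"]) auto
  next
    case (UN \<K>)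
    then show ?case by (meson Sup_upper UnionE subset_trans)
  next
    case (Basis s)
    then obtain g K \<epsilon> where s: "s = disc_nbhd g K \<epsilon>" and g: "g \<in> disc_analytic"
      and K: "compact K" "K \<subseteq> unit_disc" and \<epsilon>: "\<epsilon> > 0" by blast
    have f: "f \<in> disc_analytic" "\<And>z. z \<in> K \<Longrightarrow> cmod (f z - g z) < \<epsilon>"
      using Basis s by (auto simp: disc_nbhd_def)
    obtain m where m: "m < \<epsilon>" "\<And>z. z \<in> K \<Longrightarrow> cmod (f z - g z) \<le> m"
    proof (cases "K = {}")
      case True
      then show thesis using that[of 0] \<epsilon> by auto
    next
      case False
      have "continuous_on K (\<lambda>z. cmod (f z - g z))"
        using f(1) g K unfolding disc_analytic_def
        by (intro continuous_intros) (auto intro: holomorphic_on_imp_continuous_on holomorphic_on_subset)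
      from continuous_attains_sup[OF K(1) False this] show thesis using that f(2) by metis
    qed
    have "disc_nbhd f K (\<epsilon> - m) \<subseteq> s"
    proof
      fix h assume h: "h \<in> disc_nbhd f K (\<epsilon> - m)"
      have "cmod (h z - g z) < \<epsilon>" if "z \<in> K" for z
      proof -
        have "cmod (h z - g z) \<le> cmod (h z - f z) + cmod (f z - g z)"
          using norm_triangle_ineq[of "h z - f z" "f z - g z"] by simp
        moreover have "cmod (h z - f z) < \<epsilon> - m" using h that by (auto simp: disc_nbhd_def)
        ultimately show ?thesis using m(2)[OF that] by linarith
      qed
      with h show "h \<in> s" by (auto simp: s disc_nbhd_def)
    qed
    then show ?case using K m(1) by (intro exI[of _ K] exI[of _ "\<epsilon> - m"]) auto
  qed
  with that show thesis by blast
qed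

lemma fun_convex_sum:
  assumes C: "fun_convex C" and T: "finite T"
    and g: "\<And>t. t \<in> T \<Longrightarrow> g t \<in> C" and c: "\<And>t. t \<in> T \<Longrightarrow> c t \<ge> 0" "sum c T = 1"
  shows "(\<lambda>z. \<Sum>t\<in>T. c t *\<^sub>R g t z) \<in> C"
  using T g c
proof (induction T arbitrary: c rule: finite_induct)
  case empty
  then show ?case by simp
next
  case (insert a T)
  show ?case
  proof (cases "sum c T = 0")
    case True
    then have "\<And>t. t \<in> T \<Longrightarrow> c t = 0"
      using insert sum_nonneg_eq_0_iff[of T c] by auto
    moreover from True have "c a = 1" using insert by simp
    ultimately show ?thesis using insert by simp
  next
    case False
    define b where "b = sum c T"
    have b: "b > 0" using False insert by (simp add: b_def sum_nonneg less_le)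
    have "(\<lambda>z. \<Sum>t\<in>T. (c t / b) *\<^sub>R g t z) \<in> C"
    proof (rule insert.IH)
      show "(\<Sum>t\<in>T. c t / b) = 1" using b by (simp add: sum_divide_distrib[symmetric] b_def)
    qed (use insert b in auto)
    moreover have "g a \<in> C" using insert by simp
    moreover have "c a + b = 1" "c a \<ge> 0" using insert by (auto simp: b_def)
    ultimately have "(\<lambda>z. c a *\<^sub>R g a z + b *\<^sub>R (\<Sum>t\<in>T. (c t / b) *\<^sub>R g t z)) \<in> C"
      using C b unfolding fun_convex_def by (metis less_imp_le)
    then show ?thesis using insert b by (simp add: scaleR_sum_right)
  qed
qed

text \<open>
  Discretisation by a partition of unity: cover the circle by finitely many \<open>\<delta>\<close>-balls with
  centres in \<open>T\<close>, take continuous weights \<open>w t\<close> that sum to \<open>1\<close> and vanish off the ball around \<open>t\<close>, and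
  let \<open>c t\<close> be the integral of \<open>w t\<close>.  The error is the integral of \<open>\<Sum>t. w t x (\<kappa> t z - \<kappa> x z)\<close>, which is
  small uniformly in \<open>z\<close> by the uniform continuity of \<open>\<kappa>\<close>.
\<close>

lemma circle_average_approx:
  fixes \<kappa> :: "complex \<Rightarrow> complex \<Rightarrow> complex"
  assumes \<mu>: "circle_prob_measure \<mu>" and L: "compact L"
    and \<kappa>: "continuous_on (sphere 0 1 \<times> L) (\<lambda>(x, z). \<kappa> x z)" and \<epsilon>: "\<epsilon> > 0"
  obtains T :: "complex set" and c :: "complex \<Rightarrow> real"
  where "finite T" "T \<subseteq> sphere 0 1" "\<And>t. t \<in> T \<Longrightarrow> c t \<ge> 0" "sum c T = 1"
    "\<And>z. z \<in> L \<Longrightarrow> cmod ((\<Sum>t\<in>T. c t *\<^sub>R \<kappa> t z) - (LINT x|\<mu>. \<kappa> x z)) < \<epsilon>"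
proof -
  let ?S = "sphere (0 :: complex) 1"
  interpret prob_space \<mu> using \<mu> by (simp add: circle_prob_measure_def)
  have sets: "sets \<mu> = sets (restrict_space borel ?S)" using \<mu> by (simp add: circle_prob_measure_def)
  have space: "space \<mu> = ?S" using sets_eq_imp_space_eq[OF sets] by (simp add: space_restrict_space)
  have int: "integrable \<mu> f" if f: "continuous_on ?S f" for f :: "complex \<Rightarrow> 'b :: {banach, second_countable_topology}"
  proof -
    have "bounded (f ` ?S)" by (rule compact_imp_bounded[OF compact_continuous_image[OF f compact_sphere]])
    then obtain B where "\<And>x. x \<in> ?S \<Longrightarrow> norm (f x) \<le> B" unfolding bounded_iff by blast
    moreover have "f \<in> borel_measurable \<mu>"
      unfolding measurable_cong_sets[OF sets refl] by (rule borel_measurable_continuous_on_restrict[OF f])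
    ultimately show ?thesis
      by (intro integrable_const_bound[of _ B]) (auto simp: space)
  qed
  have "uniformly_continuous_on (?S \<times> L) (\<lambda>(x, z). \<kappa> x z)"
    by (intro compact_uniformly_continuous \<kappa> compact_Times L) simp
  from uniformly_continuous_onE[OF this, of "\<epsilon> / 2"] \<epsilon>
  obtain \<delta> where \<delta>: "\<delta> > 0" and unif: "\<And>p p'. p \<in> ?S \<times> L \<Longrightarrow> p' \<in> ?S \<times> L \<Longrightarrow> dist p' p < \<delta> \<Longrightarrow>
      dist (case p' of (x, z) \<Rightarrow> \<kappa> x z) (case p of (x, z) \<Rightarrow> \<kappa> x z) < \<epsilon> / 2"
    by (auto simp: dist_commute)
  have near: "cmod (\<kappa> t z - \<kappa> x z) < \<epsilon> / 2" if "t \<in> ?S" "x \<in> ?S" "z \<in> L" "dist x t < \<delta>" for t x z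
    using unif[of "(x, z)" "(t, z)"] that by (simp add: dist_Pair_Pair dist_commute) (simp add: dist_norm)
  obtain T where T: "T \<subseteq> ?S" "finite T" "?S \<subseteq> (\<Union>t\<in>T. ball t \<delta>)"
    using compactE_image[of ?S ?S "\<lambda>t. ball t \<delta>"] \<delta> by force
  define \<phi> where "\<phi> t x = max 0 (\<delta> - dist x t)" for t x :: complex
  define \<psi> where "\<psi> x = (\<Sum>t\<in>T. \<phi> t x)" for x
  define w where "w t x = \<phi> t x / \<psi> x" for t x
  have \<phi>0: "\<phi> t x \<ge> 0" for t x by (simp add: \<phi>_def)
  have \<psi>: "\<psi> x > 0" if x: "x \<in> ?S" for x
  proof -
    obtain t where t: "t \<in> T" "dist x t < \<delta>"
      using subsetD[OF T(3) x] by (auto simp: dist_commute)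
    then show ?thesis unfolding \<psi>_def using T(2) \<phi>0
      by (intro sum_pos2[of T t]) (auto simp: \<phi>_def)
  qed
  have w0: "w t x \<ge> 0" if "x \<in> ?S" for t x using \<phi>0 \<psi>[OF that] by (simp add: w_def)
  have w1: "(\<Sum>t\<in>T. w t x) = 1" if "x \<in> ?S" for x
    using \<psi>[OF that] by (simp add: w_def sum_divide_distrib[symmetric] \<psi>_def)
  have wc: "continuous_on ?S (w t)" for t
    unfolding w_def \<phi>_def \<psi>_def
    by (intro continuous_intros) (use \<psi> in \<open>force simp: \<psi>_def \<phi>_def\<close>)
  define c where "c t = (LINT x|\<mu>. w t x)" for t
  show thesis
  proof (rule that[OF T(2) T(1)])
    show "c t \<ge> 0" for t unfolding c_def by (rule integral_nonneg_AE) (auto simp: space w0)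
    have "sum c T = (LINT x|\<mu>. (\<Sum>t\<in>T. w t x))"
      unfolding c_def by (rule Bochner_Integration.integral_sum[symmetric]) (rule int[OF wc])
    also have "\<dots> = (LINT x|\<mu>. 1)" by (intro Bochner_Integration.integral_cong) (auto simp: space w1)
    finally show "sum c T = 1" by (simp add: prob_space)
    fix z assume z: "z \<in> L"
    have "continuous_on ?S ((\<lambda>(x, z). \<kappa> x z) \<circ> (\<lambda>x. (x, z)))"
      by (intro continuous_on_compose continuous_intros continuous_on_subset[OF \<kappa>]) (use z in auto)
    then have \<kappa>c: "continuous_on ?S (\<lambda>x. \<kappa> x z)" by (simp add: o_def)
    have wk: "integrable \<mu> (\<lambda>x. w t x *\<^sub>R \<kappa> t z)" for t
      by (rule int) (intro continuous_intros wc)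
    have "(\<Sum>t\<in>T. c t *\<^sub>R \<kappa> t z) - (LINT x|\<mu>. \<kappa> x z)
        = (LINT x|\<mu>. (\<Sum>t\<in>T. w t x *\<^sub>R \<kappa> t z) - \<kappa> x z)"
    proof -
      have "(\<Sum>t\<in>T. c t *\<^sub>R \<kappa> t z) = (LINT x|\<mu>. (\<Sum>t\<in>T. w t x *\<^sub>R \<kappa> t z))"
        unfolding c_def by (simp add: Bochner_Integration.integral_sum wk int[OF wc])
      then show ?thesis
        by (simp add: Bochner_Integration.integral_diff int[OF \<kappa>c] Bochner_Integration.integrable_sum wk)
    qed
    also have "cmod \<dots> \<le> (LINT x|\<mu>. \<epsilon> / 2)"
    proof (rule Bochner_Integration.integral_norm_bound_integral)
      show "integrable \<mu> (\<lambda>x. (\<Sum>t\<in>T. w t x *\<^sub>R \<kappa> t z) - \<kappa> x z)"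
        by (intro Bochner_Integration.integrable_diff Bochner_Integration.integrable_sum wk int[OF \<kappa>c])
      fix x assume "x \<in> space \<mu>"
      then have x: "x \<in> ?S" by (simp add: space)
      have "(\<Sum>t\<in>T. w t x *\<^sub>R \<kappa> t z) - \<kappa> x z = (\<Sum>t\<in>T. w t x *\<^sub>R (\<kappa> t z - \<kappa> x z))"
        using w1[OF x] by (simp add: scaleR_diff_right sum_subtractf flip: scaleR_sum_left)
      also have "cmod \<dots> \<le> (\<Sum>t\<in>T. w t x * (\<epsilon> / 2))"
      proof (rule sum_norm_le)
        fix t assume t: "t \<in> T"
        show "cmod (w t x *\<^sub>R (\<kappa> t z - \<kappa> x z)) \<le> w t x * (\<epsilon> / 2)"
        proof (cases "dist x t < \<delta>")
          case True
          have "t \<in> ?S" using t T(1) by blast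
          then have "cmod (\<kappa> t z - \<kappa> x z) \<le> \<epsilon> / 2" using near x z True by (simp add: less_imp_le)
          from mult_left_mono[OF this w0[OF x, of t]] show ?thesis
            using w0[OF x, of t] by simp
        qed (simp add: w_def \<phi>_def)
      qed
      also have "\<dots> = (\<Sum>t\<in>T. w t x) * (\<epsilon> / 2)" by (rule sum_distrib_right[symmetric])
      also have "\<dots> = \<epsilon> / 2" using w1[OF x] by simp
      finally show "cmod ((\<Sum>t\<in>T. w t x *\<^sub>R \<kappa> t z) - \<kappa> x z) \<le> \<epsilon> / 2" .
    qed simp
    also have "\<dots> < \<epsilon>" using \<epsilon> by (simp add: prob_space)
    finally show "cmod ((\<Sum>t\<in>T. c t *\<^sub>R \<kappa> t z) - (LINT x|\<mu>. \<kappa> x z)) < \<epsilon>" .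
  qed
qed

text \<open>
  Otherwise some closed convex \<open>C\<close> contains all starlike functions but not \<open>f\<close>, and a whole
  neighbourhood of \<open>f\<close> avoids \<open>C\<close>.  A finite convex combination of Koebe functions lies both in that
  neighbourhood and in \<open>C\<close>.
\<close>

lemma koebe_average_in_hull:
  assumes f: "f \<in> disc_analytic" and \<mu>: "circle_prob_measure \<mu>"
    and rep: "\<And>z. z \<in> unit_disc \<Longrightarrow> f z = (LINT x|\<mu>. z / (1 - x * z)\<^sup>2)"
  shows "f \<in> closed_convex_hull starlike_functions"
  unfolding closed_convex_hull_def hull_def
proof (safe)
  fix C assume C: "closedin disc_topology C" "fun_convex C" "starlike_functions \<subseteq> C"
  show "f \<in> C"
  proof (rule ccontr)
    assume "f \<notin> C"
    with f have "f \<in> disc_analytic - C" by simp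
    moreover have "openin disc_topology (disc_analytic - C)"
      using C(1) openin_diff[OF openin_topspace C(1)] by simp
    ultimately obtain K \<epsilon> where K: "compact K" "K \<subseteq> unit_disc" "\<epsilon> > 0"
      "disc_nbhd f K \<epsilon> \<subseteq> disc_analytic - C"
      using disc_topology_nbhd_base by metis
    have "continuous_on (sphere 0 1 \<times> K) (\<lambda>(x, z). z / (1 - x * z)\<^sup>2)"
      unfolding case_prod_beta using one_minus_circle_mult_ne_0 K(2) by (intro continuous_intros) force
    from circle_average_approx[OF \<mu> K(1) this K(3)]
    obtain T :: "complex set" and c :: "complex \<Rightarrow> real"
      where T: "finite T" "T \<subseteq> sphere 0 1" "\<And>t. t \<in> T \<Longrightarrow> c t \<ge> 0" "sum c T = 1"
      and approx: "\<And>z. z \<in> K \<Longrightarrow>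
        cmod ((\<Sum>t\<in>T. c t *\<^sub>R (z / (1 - t * z)\<^sup>2)) - (LINT x|\<mu>. z / (1 - x * z)\<^sup>2)) < \<epsilon>"
      by blast
    define g where "g = (\<lambda>z. \<Sum>t\<in>T. c t *\<^sub>R koebe t z)"
    have "koebe t \<in> C" if "t \<in> T" for t
    proof -
      have "cmod t = 1" using T(2) that by auto
      then show ?thesis using koebe_starlike C(3) by blast
    qed
    then have gC: "g \<in> C" unfolding g_def by (rule fun_convex_sum[OF C(2) T(1) _ T(3,4)])
    then have "g \<in> disc_analytic" using closedin_subset[OF C(1)] by auto
    moreover have "cmod (g z - f z) < \<epsilon>" if "z \<in> K" for z
    proof -
      have z: "z \<in> unit_disc" using that K(2) by auto
      have "g z = (\<Sum>t\<in>T. c t *\<^sub>R (z / (1 - t * z)\<^sup>2))" using z by (simp add: g_def koebe_def)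
      then show ?thesis using approx[OF that] rep[OF z] by simp
    qed
    ultimately have "g \<in> disc_nbhd f K \<epsilon>" by (simp add: disc_nbhd_def)
    with K(4) gC show False by blast
  qed
qed

text \<open>
  The midpoint of the Koebe functions for \<open>x = 1\<close> and \<open>x = -1\<close> is \<open>g(z) = z (1 + z\<^sup>2) / (1 - z\<^sup>2)\<^sup>2\<close>, and
  \<open>z / g(z)\<close> has poles at \<open>\<plusminus>\<i>\<close>, so \<open>g' (z / g)\<^sup>2 - 1\<close> is unbounded near these boundary points.  At
  \<open>z = \<i> / 2\<close> it already has the value \<open>-71 / 36\<close>.
\<close>

lemma hull_not_class_U:
  obtains g where "g \<in> closed_convex_hull starlike_functions" "g \<notin> class_U"
proof -
  define g where "g = (\<lambda>z. (1/2) *\<^sub>R koebe 1 z + (1/2) *\<^sub>R koebe (-1) z)"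
  have "g \<in> closed_convex_hull starlike_functions"
    unfolding closed_convex_hull_def hull_def
  proof safe
    fix C assume C: "fun_convex C" "starlike_functions \<subseteq> C"
    have "koebe 1 \<in> C" "koebe (-1) \<in> C" using koebe_starlike C(2) by auto
    then show "g \<in> C"
      unfolding g_def using C(1)[unfolded fun_convex_def, rule_format, of "koebe 1" "koebe (-1)" "1/2" "1/2"] by simp
  qed
  moreover have "g \<notin> class_U"
  proof
    assume U: "g \<in> class_U"
    define z :: complex where "z = \<i> / 2"
    have z: "z \<in> unit_disc" by (simp add: z_def norm_divide)
    have z2: "z\<^sup>2 = - 1 / 4" by (simp add: z_def power_divide)
    have D: "(1 - z\<^sup>2)\<^sup>2 = 25 / 16" unfolding z2 by (simp add: power2_eq_square)
    have "((\<lambda>z. z * (1 + z\<^sup>2)) has_field_derivative 1 + 3 * z\<^sup>2) (at z)"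
      by (auto intro!: derivative_eq_intros simp: power2_eq_square)
    moreover have "((\<lambda>z. (1 - z\<^sup>2)\<^sup>2) has_field_derivative - 4 * z * (1 - z\<^sup>2)) (at z)"
      by (auto intro!: derivative_eq_intros)
    ultimately have der: "((\<lambda>z. z * (1 + z\<^sup>2) / (1 - z\<^sup>2)\<^sup>2) has_field_derivative
        ((1 + 3 * z\<^sup>2) * (1 - z\<^sup>2)\<^sup>2 - z * (1 + z\<^sup>2) * (- 4 * z * (1 - z\<^sup>2)))
          / ((1 - z\<^sup>2)\<^sup>2 * (1 - z\<^sup>2)\<^sup>2)) (at z)"
      by (rule DERIV_divide) (simp add: z2)
    have num: "(1 + 3 * z\<^sup>2) * (1 - z\<^sup>2)\<^sup>2 - z * (1 + z\<^sup>2) * (- 4 * z * (1 - z\<^sup>2)) = - 35 / 64"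
    proof -
      have e: "z * (1 + z\<^sup>2) * (- 4 * z * (1 - z\<^sup>2)) = - 4 * z\<^sup>2 * (1 + z\<^sup>2) * (1 - z\<^sup>2)"
        by (simp add: power2_eq_square)
      show ?thesis unfolding e unfolding D unfolding z2 by simp
    qed
    have "((\<lambda>z. z * (1 + z\<^sup>2) / (1 - z\<^sup>2)\<^sup>2) has_field_derivative
        (- 35 / 64) / (25 / 16 * (25 / 16))) (at z)"
      using der unfolding num unfolding D .
    moreover have g_eq: "w * (1 + w\<^sup>2) / (1 - w\<^sup>2)\<^sup>2 = g w" if "w \<in> unit_disc" for w
    proof -
      have nz: "1 - w \<noteq> 0" "1 + w \<noteq> 0"
        using one_minus_circle_mult_ne_0[of 1 w] one_minus_circle_mult_ne_0[of "- 1" w] that by auto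
      have "1 - w\<^sup>2 = (1 - w) * (1 + w)" by (simp add: power2_eq_square algebra_simps)
      then have sq: "(1 - w\<^sup>2)\<^sup>2 = (1 - w)\<^sup>2 * (1 + w)\<^sup>2" by (simp add: power_mult_distrib)
      have "w * (1 + w\<^sup>2) * 2 = w * (1 + w)\<^sup>2 + w * (1 - w)\<^sup>2"
        by (simp add: power2_eq_square algebra_simps)
      then have num': "w * (1 + w\<^sup>2) = (w * (1 + w)\<^sup>2 + w * (1 - w)\<^sup>2) / 2" by simp
      have "g w = (w / (1 - w)\<^sup>2 + w / (1 + w)\<^sup>2) / 2"
        using that by (simp add: g_def koebe_def scaleR_conv_of_real add_divide_distrib)
      moreover have "w / (1 - w)\<^sup>2 + w / (1 + w)\<^sup>2
          = (w * (1 + w)\<^sup>2 + w * (1 - w)\<^sup>2) / ((1 - w)\<^sup>2 * (1 + w)\<^sup>2)"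
        using nz by (intro add_frac_eq) auto
      ultimately show ?thesis unfolding sq num' by simp
    qed
    ultimately have "(g has_field_derivative (- 35 / 64) / (25 / 16 * (25 / 16))) (at z)"
      using z by (auto intro: has_field_derivative_transform_within_open[of _ _ _ unit_disc])
    then have dg: "deriv g z = (- 35 / 64) / (25 / 16 * (25 / 16))" by (rule DERIV_imp_deriv)
    have ig: "id_over g z = 25 / 12"
    proof -
      have z0: "z \<noteq> 0" by (simp add: z_def)
      have gz: "g z = z * (12 / 25)" unfolding g_eq[OF z, symmetric] D unfolding z2 by simp
      show ?thesis unfolding id_over_def gz using z0 by simp
    qed
    have "deriv g z * (id_over g z)\<^sup>2 - 1 = of_real (- 71 / 36)"
      unfolding dg ig by (simp add: power2_eq_square)
    then have "cmod (deriv g z * (id_over g z)\<^sup>2 - 1) = 71 / 36" by (simp only: norm_of_real)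
    with U z show False by (force simp: class_U_def)
  qed
  ultimately show thesis using that by blast
qed

section \<open>The representation and the proper inclusion\<close>

theorem theorem2p1:
  shows "(\<forall>f\<in>class_U. \<exists>\<mu>. circle_prob_measure \<mu> \<and>
           (\<forall>z\<in>unit_disc. f z = (LINT x|\<mu>. z / (1 - x * z)\<^sup>2)))
       \<and> class_U \<subset> closed_convex_hull starlike_functions"
proof -
  have rep: "\<exists>\<mu>. circle_prob_measure \<mu> \<and>
      (\<forall>z\<in>unit_disc. f z = (LINT x|\<mu>. z / (1 - x * z)\<^sup>2))" if f: "f \<in> class_U" for f
  proof -
    obtain H where H: "H holomorphic_on unit_disc" "H 0 = 1"
      "\<And>z. z \<in> unit_disc \<Longrightarrow> Re (H z) > 1 / 2"
      "\<And>z. z \<in> unit_disc \<Longrightarrow> f z = z * deriv (\<lambda>w. w * H w) z"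
      using class_U_half_plane_mean[OF f] by blast
    obtain \<mu> where \<mu>: "circle_prob_measure \<mu>"
      "\<And>z. z \<in> unit_disc \<Longrightarrow> deriv (\<lambda>w. w * H w) z = (LINT x|\<mu>. 1 / (1 - x * z)\<^sup>2)"
      using half_plane_representation[OF H(1-3)] by blast
    have "f z = (LINT x|\<mu>. z / (1 - x * z)\<^sup>2)" if z: "z \<in> unit_disc" for z
    proof -
      have "f z = z * (LINT x|\<mu>. 1 / (1 - x * z)\<^sup>2)" using H(4)[OF z] \<mu>(2)[OF z] by simp
      also have "\<dots> = (LINT x|\<mu>. z * (1 / (1 - x * z)\<^sup>2))" by (rule integral_mult_right_zero[symmetric])
      finally show ?thesis by simp
    qed
    with \<mu>(1) show ?thesis by blast
  qed
  moreover have "class_U \<subseteq> closed_convex_hull starlike_functions"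
  proof
    fix f assume f: "f \<in> class_U"
    then have "f \<in> disc_analytic" by (simp add: class_U_def class_A_def)
    with rep[OF f] show "f \<in> closed_convex_hull starlike_functions"
      using koebe_average_in_hull by blast
  qed
  moreover have "class_U \<noteq> closed_convex_hull starlike_functions"
    using hull_not_class_U by metis
  ultimately show ?thesis by (simp add: psubset_eq)
qed

end
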